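(* Let $R$ be a commutative ring with $1$ and $\mathcal{A}$ a set of non-commuting symbols. A normalized $R$-valued multiple Dedekind symbol $D_{\mathcal{A}}$ based on $\mathcal{A}$ is shuffled if and only if its associated multiple reciprocity function $F_{\mathcal{A}}(p,q)=D_{\mathcal{A}}(p,q)D_{\mathcal{A}}(-q,p)^{-1}$ is shuffled.
   Context: $\mathcal{A}^*$ is the set of words in $\mathcal{A}$ (including $\emptyset$), $R\langle\langle\mathcal{A}\rangle\rangle$ the ring of non-commutative formal power series $\sum_{w\in\mathcal{A}^*}c_ww$ with unit group $R\langle\langle\mathcal{A}\rangle\rangle^\times$, $U=\{(p,q)\in\mathbb{Z}^2:\gcd(p,q)=1\}$. An $R$-valued multiple Dedekind symbol based on $\mathcal{A}$ is a map $D:U\to R\langle\langle\mathcal{A}\rangle\rangle^\times$ of the form $1+\sum_{w\neq\emptyset}D^w(p,q)w$ with $D(p,-q)=D(-p,q)$ and $D(p,q)=D(p,p+q)$; it is normalized if $D(1,1)=1$. An $R$-valued multiple reciprocity function based on $\mathcal{A}$ is a map $F:U\to R\langle\langle\mathcal{A}\rangle\rangle^\times$ of the form $1+\sum_{w\neq\emptyset}F^w(p,q)w$ with $F(p,-q)=F(-p,q)$, $F(p,q)F(-q,p)=1$, $F(p,p+q)F(p+q,q)=F(p,q)$. Set $D^\emptyset=F^\emptyset=1$. For words $u=a_1\cdots a_r$, $v=a_{r+1}\cdots a_{r+s}$, $Sh(u,v)$ is the multiset of words $a_{\sigma^{-1}(1)}\cdots a_{\sigma^{-1}(r+s)}$,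 one for each permutation $\sigma$ with $\sigma(1)<\dots<\sigma(r)$, $\sigma(r+1)<\dots<\sigma(r+s)$ (sums over it counted with multiplicity). $D$ (resp. $F$) is called shuffled if $D^u(p,q)D^v(p,q)=\sum_{w\in Sh(u,v)}D^w(p,q)$ (resp. the same with $F$) for all $u,v\in\mathcal{A}^*$ and all $(p,q)\in U$. *)

theory Defs
  imports Complex_Main "HOL-Library.Multiset" "HOL-Combinatorics.Permutations"
begin

text \<open>Formal power series in the non-commuting letters of type \<open>'a\<close>, given by their coefficient
  functions on words. The ring \<open>R\<langle>\<langle>\<A>\<rangle>\<rangle>\<close> over an alphabet \<open>\<A>\<close>, a set of letters which may be
  empty, is the subring \<open>ncps_over \<A>\<close> below.\<close>

typedef ('a, 'r) ncps = "UNIV :: ('a list \<Rightarrow> 'r) set"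
  morphisms ncps_coeff Abs_ncps
  by simp

lemma ncps_coeff_Abs [simp]: "ncps_coeff (Abs_ncps f) = f"
  by (simp add: Abs_ncps_inverse)

lemma ncps_eqI: "(\<And>w. ncps_coeff f w = ncps_coeff g w) \<Longrightarrow> f = g"
  by (metis ext ncps_coeff_inject)

lemma ncps_split_sum:
  fixes x :: "'a list \<Rightarrow> 'a list \<Rightarrow> 'a list \<Rightarrow> 'r::comm_monoid_add"
  shows "(\<Sum>j\<le>length w. \<Sum>i\<le>j. x (take i w) (drop i (take j w)) (drop j w)) =
    (\<Sum>i\<le>length w. \<Sum>k\<le>length w - i. x (take i w) (take k (drop i w)) (drop k (drop i w)))"
  unfolding sum.Sigma[OF finite_atMost ballI[OF finite_atMost]]
  by (rule sum.reindex_bij_witness[where i = "\<lambda>(i, k). (i + k, i)" and j = "\<lambda>(j, i). (i, j - i)"])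
     (auto simp: take_drop add.commute)

instantiation ncps :: (type, ring) ring
begin

definition zero_ncps_def: "0 = Abs_ncps (\<lambda>w. 0)"
definition plus_ncps_def: "f + g = Abs_ncps (\<lambda>w. ncps_coeff f w + ncps_coeff g w)"
definition minus_ncps_def: "f - g = Abs_ncps (\<lambda>w. ncps_coeff f w - ncps_coeff g w)"
definition uminus_ncps_def: "- f = Abs_ncps (\<lambda>w. - ncps_coeff f w)"
definition times_ncps_def:
  "f * g = Abs_ncps (\<lambda>w. \<Sum>i\<le>length w. ncps_coeff f (take i w) * ncps_coeff g (drop i w))"

instance
proof
  fix a b c :: "('a, 'b) ncps"
  show "a * b * c = a * (b * c)"
  proof (rule ncps_eqI)
    fix w
    have "ncps_coeff (a * b * c) w = (\<Sum>j\<le>length w. \<Sum>i\<le>j.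
        ncps_coeff a (take i w) * ncps_coeff b (drop i (take j w)) * ncps_coeff c (drop j w))"
      unfolding times_ncps_def ncps_coeff_Abs sum_distrib_right
      by (intro sum.cong) (auto simp: min_def)
    also have "\<dots> = (\<Sum>i\<le>length w. \<Sum>k\<le>length w - i.
        ncps_coeff a (take i w) * ncps_coeff b (take k (drop i w)) * ncps_coeff c (drop k (drop i w)))"
      by (rule ncps_split_sum)
    also have "\<dots> = ncps_coeff (a * (b * c)) w"
      by (simp add: times_ncps_def sum_distrib_left mult.assoc)
    finally show "ncps_coeff (a * b * c) w = ncps_coeff (a * (b * c)) w" .
  qed
qed (simp_all add: zero_ncps_def plus_ncps_def minus_ncps_def uminus_ncps_def times_ncps_def
       ncps_coeff_inverse algebra_simps sum.distrib)

end

instantiation ncps :: (type, "{ring, monoid_mult}") monoid_mult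
begin

definition one_ncps_def: "1 = Abs_ncps (\<lambda>w. if w = [] then 1 else 0)"

instance
proof
  fix a :: "('a, 'b) ncps"
  show "1 * a = a"
  proof (rule ncps_eqI)
    fix w
    have "ncps_coeff (1 * a) w = (\<Sum>i\<le>length w. if i = 0 then ncps_coeff a w else 0)"
      unfolding times_ncps_def one_ncps_def ncps_coeff_Abs
      by (rule sum.cong) auto
    then show "ncps_coeff (1 * a) w = ncps_coeff a w" by simp
  qed
  show "a * 1 = a"
  proof (rule ncps_eqI)
    fix w
    have "ncps_coeff (a * 1) w = (\<Sum>i\<le>length w. if i = length w then ncps_coeff a w else 0)"
      unfolding times_ncps_def one_ncps_def ncps_coeff_Abs
      by (rule sum.cong) auto
    then show "ncps_coeff (a * 1) w = ncps_coeff a w" by simp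
  qed
qed

end

definition ncps_over :: "'a set \<Rightarrow> ('a, 'r::zero) ncps set" where
  "ncps_over A = {f. \<forall>w. w \<notin> lists A \<longrightarrow> ncps_coeff f w = 0}"

definition ncps_units :: "'a set \<Rightarrow> ('a, 'r::{ring, monoid_mult}) ncps set" where
  "ncps_units A = {f \<in> ncps_over A. \<exists>g \<in> ncps_over A. f * g = 1 \<and> g * f = 1}"

definition ncps_inv :: "('a, 'r::{ring, monoid_mult}) ncps \<Rightarrow> ('a, 'r) ncps" where
  "ncps_inv f = (THE g. f * g = 1 \<and> g * f = 1)"

lemma ncps_inv_eqI:
  assumes "f * g = 1" and "g * f = 1"
  shows "ncps_inv f = g"
  unfolding ncps_inv_def
proof (rule the_equality)
  fix h assume "f * h = 1 \<and> h * f = 1"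
  then show "h = g" by (metis assms(1) mult.assoc mult_1_left mult_1_right)
qed (use assms in blast)

lemma ncps_unitsD:
  assumes "f \<in> ncps_units A"
  shows "f \<in> ncps_over A" and "ncps_inv f \<in> ncps_over A"
    and "f * ncps_inv f = 1" and "ncps_inv f * f = 1"
proof -
  from assms obtain g where "f \<in> ncps_over A" "g \<in> ncps_over A" "f * g = 1" "g * f = 1"
    by (auto simp: ncps_units_def)
  with ncps_inv_eqI[of f g]
  show "f \<in> ncps_over A" "ncps_inv f \<in> ncps_over A" "f * ncps_inv f = 1" "ncps_inv f * f = 1"
    by simp_all
qed

lemma ncps_inv_units: "f \<in> ncps_units A \<Longrightarrow> ncps_inv f \<in> ncps_units A"
  using ncps_unitsD[of f A] by (auto simp: ncps_units_def)

lemma ncps_over_mult: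
  assumes "f \<in> ncps_over A" and "g \<in> ncps_over A"
  shows "f * g \<in> ncps_over A"
proof -
  have "ncps_coeff f (take i w) * ncps_coeff g (drop i w) = 0" if "w \<notin> lists A" for i w
  proof -
    have "take i w @ drop i w \<notin> lists A" using that by simp
    then have "take i w \<notin> lists A \<or> drop i w \<notin> lists A"
      unfolding append_in_lists_conv by blast
    then show ?thesis using assms by (auto simp: ncps_over_def)
  qed
  then show ?thesis by (simp add: ncps_over_def times_ncps_def)
qed

lemma ncps_units_mult:
  assumes "f \<in> ncps_units A" and "g \<in> ncps_units A"
  shows "f * g \<in> ncps_units A"
proof -
  note f = ncps_unitsD[OF assms(1)] and g = ncps_unitsD[OF assms(2)]
  have "(f * g) * (ncps_inv g * ncps_inv f) = f * (g * ncps_inv g) * ncps_inv f"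
    by (simp only: mult.assoc)
  moreover have "(ncps_inv g * ncps_inv f) * (f * g) = ncps_inv g * (ncps_inv f * f) * g"
    by (simp only: mult.assoc)
  ultimately show ?thesis
    using f g ncps_over_mult unfolding ncps_units_def by fastforce
qed

definition dedekind_U :: "(int \<times> int) set" where
  "dedekind_U = {(p, q). gcd p q = 1}"

text \<open>The sort \<open>{comm_ring, comm_monoid_mult}\<close> of the coefficients is that of commutative rings
  with \<open>1\<close>; unlike \<open>comm_ring_1\<close> it does not exclude the zero ring.\<close>

definition multiple_dedekind_symbol ::
    "'a set \<Rightarrow> (int \<times> int \<Rightarrow> ('a, 'r::{comm_ring, comm_monoid_mult}) ncps) \<Rightarrow> bool" where
  "multiple_dedekind_symbol A D \<longleftrightarrow> (\<forall>(p, q) \<in> dedekind_U.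
     D (p, q) \<in> ncps_units A \<and> ncps_coeff (D (p, q)) [] = 1 \<and>
     D (p, - q) = D (- p, q) \<and> D (p, q) = D (p, p + q))"

definition normalized_symbol ::
    "(int \<times> int \<Rightarrow> ('a, 'r::{comm_ring, comm_monoid_mult}) ncps) \<Rightarrow> bool" where
  "normalized_symbol D \<longleftrightarrow> D (1, 1) = 1"

definition multiple_reciprocity_function ::
    "'a set \<Rightarrow> (int \<times> int \<Rightarrow> ('a, 'r::{comm_ring, comm_monoid_mult}) ncps) \<Rightarrow> bool" where
  "multiple_reciprocity_function A F \<longleftrightarrow> (\<forall>(p, q) \<in> dedekind_U.
     F (p, q) \<in> ncps_units A \<and> ncps_coeff (F (p, q)) [] = 1 \<and>
     F (p, - q) = F (- p, q) \<and> F (p, q) * F (- q, p) = 1 \<and>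
     F (p, p + q) * F (p + q, q) = F (p, q))"

definition associated_reciprocity ::
    "(int \<times> int \<Rightarrow> ('a, 'r::{comm_ring, comm_monoid_mult}) ncps) \<Rightarrow> int \<times> int \<Rightarrow> ('a, 'r) ncps" where
  "associated_reciprocity D = (\<lambda>(p, q). D (p, q) * ncps_inv (D (- q, p)))"

lemma multiple_reciprocity_function_associated:
  assumes "multiple_dedekind_symbol A D"
  shows "multiple_reciprocity_function A (associated_reciprocity D)"
  unfolding multiple_reciprocity_function_def
proof (clarify, intro conjI)
  fix p q assume U: "(p, q) \<in> dedekind_U"
  have mem: "(a, b) \<in> dedekind_U \<longleftrightarrow> gcd a b = 1" for a b by (simp add: dedekind_U_def)
  have pq: "gcd p q = 1" "gcd q p = 1" using U by (simp_all add: mem gcd.commute)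
  have un: "D (a, b) \<in> ncps_units A" and c1: "ncps_coeff (D (a, b)) [] = 1"
    and neg: "D (a, - b) = D (- a, b)" and tr: "D (a, b) = D (a, a + b)"
    if "gcd a b = 1" for a b
    using assms that unfolding multiple_dedekind_symbol_def mem[symmetric] by blast+
  have D1: "D (p, q) \<in> ncps_units A" and D2: "D (- q, p) \<in> ncps_units A"
    using un pq by simp_all
  note inv1 = ncps_unitsD[OF D1] and inv2 = ncps_unitsD[OF D2]
  have neg2: "D (- a, - b) = D (a, b)" if "gcd a b = 1" for a b
    using neg[of a "- b"] that by simp
  show "associated_reciprocity D (p, q) \<in> ncps_units A"
    using D1 D2 by (simp add: associated_reciprocity_def ncps_units_mult ncps_inv_units)
  have coeff_mult: "ncps_coeff (f * g) [] = ncps_coeff f [] * ncps_coeff g []"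
    for f g :: "('a, 'b) ncps" by (simp add: times_ncps_def)
  have "ncps_coeff (D (- q, p) * ncps_inv (D (- q, p))) [] = 1"
    unfolding inv2(3) by (simp add: one_ncps_def)
  then have "ncps_coeff (ncps_inv (D (- q, p))) [] = 1"
    using c1[of "- q" p] pq by (simp add: coeff_mult)
  then show "ncps_coeff (associated_reciprocity D (p, q)) [] = 1"
    using c1[OF pq(1)] by (simp add: associated_reciprocity_def coeff_mult)
  show "associated_reciprocity D (p, - q) = associated_reciprocity D (- p, q)"
    using neg[of p q] neg2[of q p] neg2[of "- q" p] pq neg[of q p]
    by (simp add: associated_reciprocity_def)
  have "D (p, q) * ncps_inv (D (- q, p)) * (D (- q, p) * ncps_inv (D (p, q))) =
      D (p, q) * (ncps_inv (D (- q, p)) * D (- q, p)) * ncps_inv (D (p, q))"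
    by (simp only: mult.assoc)
  then show "associated_reciprocity D (p, q) * associated_reciprocity D (- q, p) = 1"
    using inv1 inv2 neg2[of p q] pq by (simp add: associated_reciprocity_def)
  have g: "gcd (p + q) q = 1" "gcd (p + q) p = 1" "gcd p (p + q) = 1" "gcd q (p + q) = 1"
    using pq gcd_add1[of p q] gcd_add2[of p q] gcd_add1[of q p] gcd_add2[of q p]
    by (simp_all only: add.commute[of q p] gcd.commute[of "p + q"])
  have e1: "D (- (p + q), p) = D (p + q, q)"
    using neg[of "p + q" p] tr[of "p + q" "- p"] g by simp
  have e2: "D (- q, p + q) = D (- q, p)"
    using tr[of "- q" "p + q"] g by simp
  note i = ncps_unitsD[OF un[OF g(1)]]
  have "D (p, q) * ncps_inv (D (p + q, q)) * (D (p + q, q) * ncps_inv (D (- q, p))) =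
      D (p, q) * (ncps_inv (D (p + q, q)) * D (p + q, q)) * ncps_inv (D (- q, p))"
    by (simp only: mult.assoc)
  then show "associated_reciprocity D (p, p + q) * associated_reciprocity D (p + q, q) =
      associated_reciprocity D (p, q)"
    using i tr[OF pq(1)] e1 e2 by (simp add: associated_reciprocity_def)
qed

text \<open>Positions are counted from \<open>0\<close> instead of \<open>1\<close>.\<close>

definition shuffle_perms :: "nat \<Rightarrow> nat \<Rightarrow> (nat \<Rightarrow> nat) set" where
  "shuffle_perms r s = {\<sigma>. \<sigma> permutes {..<r + s} \<and>
     strict_mono_on {..<r} \<sigma> \<and> strict_mono_on {r..<r + s} \<sigma>}"

definition Sh :: "'a list \<Rightarrow> 'a list \<Rightarrow> 'a list multiset" where
  "Sh u v = image_mset (\<lambda>\<sigma>. map (\<lambda>i. (u @ v) ! (inv \<sigma> i)) [0..<length u + length v])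
     (mset_set (shuffle_perms (length u) (length v)))"

lemma finite_shuffle_perms: "finite (shuffle_perms r s)"
  by (rule finite_subset[OF _ finite_permutations[of "{..<r + s}"]]) (auto simp: shuffle_perms_def)

definition shuffled ::
    "'a set \<Rightarrow> (int \<times> int \<Rightarrow> ('a, 'r::{comm_ring, comm_monoid_mult}) ncps) \<Rightarrow> bool" where
  "shuffled A G \<longleftrightarrow> (\<forall>(p, q) \<in> dedekind_U. \<forall>u \<in> lists A. \<forall>v \<in> lists A.
     ncps_coeff (G (p, q)) u * ncps_coeff (G (p, q)) v =
     (\<Sum>w\<in>#Sh u v. ncps_coeff (G (p, q)) w))"

end

theory Submission
  imports Defs
begin

text \<open>Call a series group-like if its constant term is \<open>1\<close> and it satisfies the shuffle relations.
  Cutting a word in two is compatible with shuffling, so group-like series are closed under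
  products; by induction on the length of words, \<open>g\<close> is group-like whenever \<open>f\<close> and \<open>f g\<close> are.
  Hence the group-like units form a group, which gives the forward direction.
  Conversely, \<open>D(p,q) = F(p,q) D(-q,p)\<close> together with \<open>D(p,q) = D(p,q mod p)\<close> expresses
  \<open>D(p,q)\<close>, by the Euclidean algorithm, as a product of values of \<open>F\<close>.\<close>

section \<open>Shuffles of words\<close>

text \<open>Shuffles counted with multiplicity, built by choosing which word supplies the first
  letter. This recursion replaces the permutations in \<open>Sh\<close> and carries the later
  inductions.\<close>

fun shuffle_mset :: "'a list \<Rightarrow> 'a list \<Rightarrow> 'a list multiset" where
  "shuffle_mset [] v = {#v#}"
| "shuffle_mset (a # u) [] = {#a # u#}"
| "shuffle_mset (a # u) (b # v) =
    image_mset (Cons a) (shuffle_mset u (b # v)) + image_mset (Cons b) (shuffle_mset (a # u) v)"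

lemma shuffle_mset_Nil2 [simp]: "shuffle_mset u [] = {#u#}"
  by (cases u) auto

lemma length_shuffle_mset: "w \<in># shuffle_mset u v \<Longrightarrow> length w = length u + length v"
  by (induction u v arbitrary: w rule: shuffle_mset.induct) auto

text \<open>With distinct entries the two branches of the recursion are disjoint, so each shuffle
  arises exactly once and a set suffices. Multiplicities appear only when \<open>f\<close>
  identifies entries.\<close>

lemma image_mset_map_shuffles:
  assumes "distinct xs" "distinct ys" "set xs \<inter> set ys = {}"
  shows "image_mset (map f) (mset_set (shuffles xs ys)) = shuffle_mset (map f xs) (map f ys)"
  using assms
proof (induction xs ys rule: shuffles.induct)
  case (3 x xs y ys)
  have "(#) x ` shuffles xs (y # ys) \<inter> (#) y ` shuffles (x # xs) ys = {}"
    using 3 by auto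
  then have "mset_set (shuffles (x # xs) (y # ys)) =
      image_mset ((#) x) (mset_set (shuffles xs (y # ys))) +
      image_mset ((#) y) (mset_set (shuffles (x # xs) ys))"
    by (simp add: mset_set_Union image_mset_mset_set)
  moreover have "image_mset (map f) (mset_set (shuffles xs (y # ys))) =
      shuffle_mset (map f xs) (map f (y # ys))"
    "image_mset (map f) (mset_set (shuffles (x # xs) ys)) =
      shuffle_mset (map f (x # xs)) (map f ys)"
    using 3 by auto
  moreover have "image_mset (map f) (image_mset ((#) z) M) =
      image_mset ((#) (f z)) (image_mset (map f) M)" for z M
    by (simp add: multiset.map_comp comp_def)
  ultimately show ?case
    by simp
qed auto

section \<open>Shuffle permutations as lists of positions\<close>

lemma sorted_wrt_filter_iff:
  "sorted_wrt R (filter P xs) \<longleftrightarrow> sorted_wrt (\<lambda>x y. P x \<and> P y \<longrightarrow> R x y) xs"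
  by (induction xs) auto

text \<open>The list of values of \<open>inv \<sigma>\<close> names, place by place, the position
  that \<open>\<sigma>\<close> sends there. So \<open>\<sigma>\<close> is increasing on
  \<open>B\<close> exactly when the list meets the elements of \<open>B\<close> in increasing
  order.\<close>

lemma permutes_strict_mono_on_iff_sorted_wrt:
  fixes \<sigma> :: "nat \<Rightarrow> nat"
  assumes "\<sigma> permutes {..<n}" and "B \<subseteq> {..<n}"
  shows "strict_mono_on B \<sigma> \<longleftrightarrow>
    sorted_wrt (<) (filter (\<lambda>x. x \<in> B) (map (inv \<sigma>) [0..<n]))"
proof -
  have inv: "inv \<sigma> (\<sigma> x) = x" "\<sigma> (inv \<sigma> x) = x" for x
    using permutes_inverses[OF assms(1)] by auto
  have lt: "\<sigma> x < n \<longleftrightarrow> x < n" for x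
    using permutes_in_image[OF assms(1), of x] by simp
  have "sorted_wrt (<) (filter (\<lambda>x. x \<in> B) (map (inv \<sigma>) [0..<n])) \<longleftrightarrow>
      (\<forall>i j. i < j \<longrightarrow> j < n \<longrightarrow> inv \<sigma> i \<in> B \<and> inv \<sigma> j \<in> B \<longrightarrow> inv \<sigma> i < inv \<sigma> j)"
    unfolding sorted_wrt_filter_iff
    unfolding sorted_wrt_iff_nth_less by auto
  also have "\<dots> \<longleftrightarrow> (\<forall>x\<in>B. \<forall>y\<in>B. \<sigma> x < \<sigma> y \<longrightarrow> x < y)"
  proof (intro iffI ballI allI impI)
    fix x y
    assume *: "\<forall>i j. i < j \<longrightarrow> j < n \<longrightarrow> inv \<sigma> i \<in> B \<and> inv \<sigma> j \<in> B \<longrightarrow> inv \<sigma> i < inv \<sigma> j"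
      and xy: "x \<in> B" "y \<in> B" "\<sigma> x < \<sigma> y"
    have "\<sigma> y < n" using xy(2) assms(2) lt by auto
    with *[rule_format, of "\<sigma> x" "\<sigma> y"] xy show "x < y" by (simp add: inv)
  next
    fix i j
    assume *: "\<forall>x\<in>B. \<forall>y\<in>B. \<sigma> x < \<sigma> y \<longrightarrow> x < y"
      and "i < j" "inv \<sigma> i \<in> B \<and> inv \<sigma> j \<in> B"
    then show "inv \<sigma> i < inv \<sigma> j"
      using *[rule_format, of "inv \<sigma> i" "inv \<sigma> j"] by (simp add: inv)
  qed
  also have "\<dots> \<longleftrightarrow> strict_mono_on B \<sigma>"
    unfolding strict_mono_on_def
  proof (intro iffI ballI allI impI)
    fix x y
    assume *: "\<forall>x\<in>B. \<forall>y\<in>B. \<sigma> x < \<sigma> y \<longrightarrow> x < y" and xy: "x \<in> B \<and> y \<in> B \<and> x < y"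
    have "\<sigma> x \<noteq> \<sigma> y" using inv(1)[of x] inv(1)[of y] xy by auto
    moreover have "\<not> \<sigma> y < \<sigma> x" using *[rule_format, of y x] xy by auto
    ultimately show "\<sigma> x < \<sigma> y" by linarith
  next
    fix x y
    assume *: "\<forall>r s. r \<in> B \<and> s \<in> B \<and> r < s \<longrightarrow> \<sigma> r < \<sigma> s"
      and xy: "x \<in> B" "y \<in> B" "\<sigma> x < \<sigma> y"
    show "x < y"
      using *[rule_format, of y x] xy by (cases x y rule: linorder_cases) auto
  qed
  finally show ?thesis by simp
qed

lemma bij_betw_shuffle_perms_shuffles:
  "bij_betw (\<lambda>\<sigma>. map (inv \<sigma>) [0..<r + s]) (shuffle_perms r s) (shuffles [0..<r] [r..<r + s])"
  (is "bij_betw ?L _ ?S")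
proof (rule bij_betw_imageI)
  show "inj_on ?L (shuffle_perms r s)"
  proof (rule inj_onI)
    fix \<sigma> \<tau> assume *: "\<sigma> \<in> shuffle_perms r s" "\<tau> \<in> shuffle_perms r s" and eq: "?L \<sigma> = ?L \<tau>"
    have p: "\<sigma> permutes {..<r + s}" "\<tau> permutes {..<r + s}"
      using * by (auto simp: shuffle_perms_def)
    have "inv \<sigma> x = inv \<tau> x" for x
    proof (cases "x < r + s")
      case True
      with eq show ?thesis by (simp only: map_eq_conv) simp
    next
      case False
      then have "x \<notin> {..<r + s}" by simp
      then show ?thesis
        using p[THEN permutes_inv, THEN permutes_not_in] by simp
    qed
    then have "inv \<sigma> = inv \<tau>" by (rule ext)
    then have "inv (inv \<sigma>) = inv (inv \<tau>)" by (rule arg_cong)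
    then show "\<sigma> = \<tau>" unfolding p[THEN permutes_inv_inv] .
  qed
  have eq: "?L \<sigma> \<in> ?S \<longleftrightarrow> \<sigma> \<in> shuffle_perms r s" if p: "\<sigma> permutes {..<r + s}" for \<sigma>
  proof -
    have st: "set (?L \<sigma>) = {..<r + s}"
      using permutes_image[OF permutes_inv[OF p]] by (simp add: lessThan_atLeast0)
    \<comment> \<open>A strictly increasing list is determined by its set of entries, and here every
      element of the interval occurs.\<close>
    have "sorted_wrt (<) (filter (\<lambda>x. x \<in> {a..<b}) (?L \<sigma>)) \<longleftrightarrow>
        filter (\<lambda>x. x \<in> {a..<b}) (?L \<sigma>) = [a..<b]" if "b \<le> r + s" for a b
    proof
      assume "sorted_wrt (<) (filter (\<lambda>x. x \<in> {a..<b}) (?L \<sigma>))"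
      moreover have "set (filter (\<lambda>x. x \<in> {a..<b}) (?L \<sigma>)) = set [a..<b]"
        unfolding set_filter st using that by auto
      ultimately show "filter (\<lambda>x. x \<in> {a..<b}) (?L \<sigma>) = [a..<b]"
        by (intro strict_sorted_equal) auto
    qed (simp only: sorted_wrt_upt)
    note this[of r 0] this[of "r + s" r]
    moreover have "?L \<sigma> \<in> ?S \<longleftrightarrow>
      filter (\<lambda>x. x \<in> {0..<r}) (?L \<sigma>) = [0..<r] \<and>
      filter (\<lambda>x. x \<in> {r..<r + s}) (?L \<sigma>) = [r..<r + s]"
    proof
      assume *: "?L \<sigma> \<in> ?S"
      have "filter (\<lambda>x. x \<in> set [0..<r]) (?L \<sigma>) = [0..<r]"
        by (rule filter_shuffles_disjoint1(1)[OF _ *]) auto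
      moreover have "filter (\<lambda>x. x \<in> set [r..<r + s]) (?L \<sigma>) = [r..<r + s]"
        by (rule filter_shuffles_disjoint2(1)[OF _ *]) auto
      ultimately show "filter (\<lambda>x. x \<in> {0..<r}) (?L \<sigma>) = [0..<r] \<and>
        filter (\<lambda>x. x \<in> {r..<r + s}) (?L \<sigma>) = [r..<r + s]" by simp
    next
      assume *: "filter (\<lambda>x. x \<in> {0..<r}) (?L \<sigma>) = [0..<r] \<and>
        filter (\<lambda>x. x \<in> {r..<r + s}) (?L \<sigma>) = [r..<r + s]"
      \<comment> \<open>All entries lie below \<open>r + s\<close>, so missing the first block means
        lying in the second.\<close>
      have "filter (\<lambda>x. \<not> x \<in> {0..<r}) (?L \<sigma>) = filter (\<lambda>x. x \<in> {r..<r + s}) (?L \<sigma>)"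
        by (rule filter_cong[OF refl]) (use st in auto)
      with * have "filter (\<lambda>x. \<not> x \<in> {0..<r}) (?L \<sigma>) = [r..<r + s]"
        by (simp only:)
      with * show "?L \<sigma> \<in> ?S"
        using partition_in_shuffles[of "?L \<sigma>" "\<lambda>x. x \<in> {0..<r}"] by (simp only:)
    qed
    moreover have "\<sigma> \<in> shuffle_perms r s \<longleftrightarrow>
        strict_mono_on {0..<r} \<sigma> \<and> strict_mono_on {r..<r + s} \<sigma>"
      using p by (simp add: shuffle_perms_def lessThan_atLeast0)
    moreover have "{0..<r} \<subseteq> {..<r + s}" "{r..<r + s} \<subseteq> {..<r + s}" by auto
    note this[THEN permutes_strict_mono_on_iff_sorted_wrt[OF p]]
    ultimately show ?thesis by (simp only: le_add1 order_refl)
  qed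
  have "l \<in> ?L ` shuffle_perms r s" if l: "l \<in> ?S" for l
  proof -
    have len: "length l = r + s"
      using length_shuffles[OF l] by simp
    have st: "set l = {..<r + s}"
      unfolding set_shuffles[OF l] set_upt by auto
    have d: "distinct l"
      by (rule distinct_disjoint_shuffles[OF _ _ _ l]) auto
    \<comment> \<open>The list read as a permutation, extended by the identity as
      \<open>permutes\<close> demands. The preimage of \<open>l\<close> is its inverse, since lists
      record \<open>inv \<sigma>\<close>.\<close>
    define \<pi> where "\<pi> i = (if i < r + s then l ! i else i)" for i
    have "bij_betw ((!) l) {..<r + s} {..<r + s}"
      by (rule bij_betw_nth[OF d]) (simp_all only: len st)
    moreover have "bij_betw \<pi> {..<r + s} {..<r + s} \<longleftrightarrow> bij_betw ((!) l) {..<r + s} {..<r + s}"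
      by (rule bij_betw_cong) (simp add: \<pi>_def)
    ultimately have "bij_betw \<pi> {..<r + s} {..<r + s}" by (simp only:)
    then have p: "\<pi> permutes {..<r + s}"
      by (rule bij_imp_permutes) (simp add: \<pi>_def)
    have L: "?L (inv \<pi>) = l"
      unfolding permutes_inv_inv[OF p] by (rule nth_equalityI) (auto simp: \<pi>_def len)
    have "inv \<pi> \<in> shuffle_perms r s"
      using eq[OF permutes_inv[OF p], unfolded L] l by (rule iffD1)
    then show ?thesis
      by (rule image_eqI[where f = ?L, OF L[symmetric]])
  qed
  moreover have "?L \<sigma> \<in> ?S" if "\<sigma> \<in> shuffle_perms r s" for \<sigma>
  proof -
    have "\<sigma> permutes {..<r + s}" using that by (simp add: shuffle_perms_def)
    from eq[OF this] that show ?thesis by (simp only:)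
  qed
  ultimately show "?L ` shuffle_perms r s = ?S"
    by (intro equalityI image_subsetI subsetI)
qed

text \<open>The positions of \<open>u @ v\<close> are distinct, so they can be shuffled as a set.
  Replacing positions by letters afterwards produces the multiplicities.\<close>

lemma Sh_eq_shuffle_mset: "Sh u v = shuffle_mset u v"
proof -
  let ?r = "length u" and ?s = "length v"
  note bij = bij_betw_shuffle_perms_shuffles[of ?r ?s]
  have "Sh u v = image_mset (map ((!) (u @ v)))
      (image_mset (\<lambda>\<sigma>. map (inv \<sigma>) [0..<?r + ?s]) (mset_set (shuffle_perms ?r ?s)))"
    by (simp add: Sh_def multiset.map_comp comp_def)
  also have "\<dots> = image_mset (map ((!) (u @ v))) (mset_set (shuffles [0..<?r] [?r..<?r + ?s]))"
    using image_mset_mset_set[OF bij_betw_imp_inj_on[OF bij]] bij_betw_imp_surj_on[OF bij]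
    by simp
  also have "\<dots> = shuffle_mset (map ((!) (u @ v)) [0..<?r]) (map ((!) (u @ v)) [?r..<?r + ?s])"
    by (rule image_mset_map_shuffles) auto
  also have "map ((!) (u @ v)) [0..<?r] = u"
    by (rule nth_equalityI) (auto simp: nth_append)
  also have "map ((!) (u @ v)) [?r..<?r + ?s] = v"
    by (rule nth_equalityI) (auto simp: nth_append)
  finally show ?thesis .
qed

text \<open>Deconcatenation is compatible with shuffling: cutting a shuffle of \<open>u\<close> and
  \<open>v\<close> amounts to cutting both words, then shuffling the prefixes and the suffixes
  separately. The summand \<open>x\<close> is arbitrary because the induction absorbs the first
  letter into it.\<close>

lemma sum_shuffle_mset_splits:
  fixes x :: "'a list \<Rightarrow> 'a list \<Rightarrow> 'r::comm_monoid_add"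
  shows "(\<Sum>w\<in>#shuffle_mset u v. \<Sum>i\<le>length w. x (take i w) (drop i w)) =
    (\<Sum>i\<le>length u. \<Sum>j\<le>length v. \<Sum>w1\<in>#shuffle_mset (take i u) (take j v).
       \<Sum>w2\<in>#shuffle_mset (drop i u) (drop j v). x w1 w2)"
proof (induction u v arbitrary: x rule: shuffle_mset.induct)
  case (3 a u b v)
  note IH1 = "3.IH"(1)[of "\<lambda>w1. x (a # w1)"] and IH2 = "3.IH"(2)[of "\<lambda>w1. x (b # w1)"]
  \<comment> \<open>The cut before the first letter is split off. Every other cut leaves that
    letter, \<open>a\<close> or \<open>b\<close>, in the prefix.\<close>
  have "(\<Sum>w\<in>#shuffle_mset (a # u) (b # v). \<Sum>i\<le>length w. x (take i w) (drop i w)) =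
    (\<Sum>w\<in>#shuffle_mset (a # u) (b # v). x [] w) +
    ((\<Sum>w\<in>#shuffle_mset u (b # v). \<Sum>i\<le>length w. x (a # take i w) (drop i w)) +
     (\<Sum>w\<in>#shuffle_mset (a # u) v. \<Sum>i\<le>length w. x (b # take i w) (drop i w)))"
    by (simp add: multiset.map_comp comp_def sum.atMost_Suc_shift sum_mset.distrib ac_simps
      del: sum.atMost_Suc)
  then show ?case
    unfolding IH1 IH2
    by (simp add: multiset.map_comp comp_def sum.atMost_Suc_shift sum_mset.distrib sum.distrib
      ac_simps del: sum.atMost_Suc)
qed simp_all

section \<open>Group-like series\<close>

text \<open>For series over \<open>A\<close> these are the group-like elements for the coproduct
  that makes every letter primitive.\<close>

definition group_like :: "'a set \<Rightarrow> ('a, 'r::{comm_ring, comm_monoid_mult}) ncps \<Rightarrow> bool" where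
  "group_like A f \<longleftrightarrow> ncps_coeff f [] = 1 \<and> (\<forall>u\<in>lists A. \<forall>v\<in>lists A.
     ncps_coeff f u * ncps_coeff f v = (\<Sum>w\<in>#shuffle_mset u v. ncps_coeff f w))"

lemma group_likeD:
  assumes "group_like A f"
  shows "ncps_coeff f [] = 1"
    and "u \<in> lists A \<Longrightarrow> v \<in> lists A \<Longrightarrow>
      (\<Sum>w\<in>#shuffle_mset u v. ncps_coeff f w) = ncps_coeff f u * ncps_coeff f v"
  using assms by (auto simp: group_like_def)

section \<open>Products, cancellation and inverses of group-like series\<close>

lemma ncps_coeff_mult:
  "ncps_coeff (f * g) w = (\<Sum>i\<le>length w. ncps_coeff f (take i w) * ncps_coeff g (drop i w))"
  by (simp add: times_ncps_def)

text \<open>After cutting, the shuffle sums over prefixes collapse by the relations for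
  \<open>f\<close>. Those over suffixes stay unevaluated, because in the cancellation argument the
  relations for \<open>g\<close> are what is to be proved.\<close>

lemma sum_shuffle_mset_mult:
  fixes f g :: "('a, 'r::{comm_ring, comm_monoid_mult}) ncps"
  assumes "group_like A f" "u \<in> lists A" "v \<in> lists A"
  shows "(\<Sum>w\<in>#shuffle_mset u v. ncps_coeff (f * g) w) =
    (\<Sum>i\<le>length u. \<Sum>j\<le>length v. ncps_coeff f (take i u) * ncps_coeff f (take j v) *
      (\<Sum>w\<in>#shuffle_mset (drop i u) (drop j v). ncps_coeff g w))"
proof -
  have mem: "take i u \<in> lists A" "take j v \<in> lists A" for i j
    using assms by (auto dest: in_set_takeD)
  show ?thesis
    unfolding ncps_coeff_mult
      sum_shuffle_mset_splits[where x = "\<lambda>w1 w2. ncps_coeff f w1 * ncps_coeff g w2"]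
    by (simp add: sum_mset_distrib_left[symmetric] sum_mset_distrib_right[symmetric]
      group_likeD(2)[OF assms(1) mem])
qed

text \<open>Brought into the shape of the preceding expansion, so that the two can be compared term
  by term. Commutativity of the coefficients is what allows the regrouping.\<close>

lemma ncps_coeff_mult_mult:
  fixes f g :: "('a, 'r::{comm_ring, comm_monoid_mult}) ncps"
  shows "ncps_coeff (f * g) u * ncps_coeff (f * g) v =
    (\<Sum>i\<le>length u. \<Sum>j\<le>length v. ncps_coeff f (take i u) * ncps_coeff f (take j v) *
      (ncps_coeff g (drop i u) * ncps_coeff g (drop j v)))"
  by (simp add: ncps_coeff_mult sum_product ac_simps)

lemma group_like_one: "group_like A 1"
proof -
  have "(\<Sum>w\<in>#shuffle_mset u v. ncps_coeff 1 w) =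
      (ncps_coeff 1 u * ncps_coeff 1 v :: 'r::{comm_ring, comm_monoid_mult})" for u v :: "'a list"
  proof (cases "u = [] \<and> v = []")
    case False
    \<comment> \<open>Shuffles of two words that are not both empty are nonempty, so both sides
      vanish.\<close>
    then have "ncps_coeff 1 w = (0 :: 'r)" if "w \<in># shuffle_mset u v" for w
      using length_shuffle_mset[OF that] by (auto simp: one_ncps_def)
    then show ?thesis
      using False by (auto simp: one_ncps_def intro!: sum_mset.neutral)
  qed (simp add: one_ncps_def)
  then show ?thesis
    unfolding group_like_def by (intro conjI ballI) (simp add: one_ncps_def, rule sym)
qed

lemma group_like_mult:
  assumes "group_like A f" "group_like A g"
  shows "group_like A (f * g)"
proof -
  have "drop i u \<in> lists A" if "u \<in> lists A" for i u
    using that by (auto dest: in_set_dropD)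
  then show ?thesis
    using assms(1) group_likeD[OF assms(1)] group_likeD[OF assms(2)]
    unfolding group_like_def[of A "f * g"]
    by (simp add: sum_shuffle_mset_mult ncps_coeff_mult_mult) (simp add: ncps_coeff_mult)
qed

lemma group_like_mult_cancel_left:
  assumes f: "group_like A f" and fg: "group_like A (f * g)"
  shows "group_like A g"
proof -
  have f1: "ncps_coeff f [] = 1" by (rule group_likeD(1)[OF f])
  have "ncps_coeff g u * ncps_coeff g v = (\<Sum>w\<in>#shuffle_mset u v. ncps_coeff g w)"
    if "u \<in> lists A" "v \<in> lists A" for u v
    using that
  proof (induction "length u + length v" arbitrary: u v rule: less_induct)
    case less
    let ?c = "\<lambda>(i, j). ncps_coeff f (take i u) * ncps_coeff f (take j v)"
    let ?P = "\<lambda>(i, j). ncps_coeff g (drop i u) * ncps_coeff g (drop j v)"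
    let ?Q = "\<lambda>(i, j). \<Sum>w\<in>#shuffle_mset (drop i u) (drop j v). ncps_coeff g w"
    let ?I = "{..length u} \<times> {..length v}"
    have "(\<Sum>k\<in>?I. ?c k * ?P k) = (\<Sum>k\<in>?I. ?c k * ?Q k)"
      using sum_shuffle_mset_mult[OF f less.prems, of g] ncps_coeff_mult_mult[of f g u v]
        group_likeD(2)[OF fg less.prems]
      by (simp add: sum.cartesian_product case_prod_unfold)
    \<comment> \<open>Any cut other than \<open>(0, 0)\<close> removes letters from \<open>u\<close>
      or \<open>v\<close>, so the induction hypothesis applies to the suffixes.\<close>
    moreover have "(\<Sum>k\<in>?I - {(0, 0)}. ?c k * ?P k) = (\<Sum>k\<in>?I - {(0, 0)}. ?c k * ?Q k)"
    proof (rule sum.cong[OF refl])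
      fix k assume k: "k \<in> ?I - {(0, 0)}"
      obtain i j where [simp]: "k = (i, j)" by (cases k)
      have "drop i u \<in> lists A" "drop j v \<in> lists A"
        using less.prems by (auto dest: in_set_dropD)
      then show "?c k * ?P k = ?c k * ?Q k"
        using less.hyps[of "drop i u" "drop j v"] k by auto
    qed
    \<comment> \<open>Only the uncut pair remains. Its factor \<open>?c (0, 0)\<close> is the square
      of the constant term of \<open>f\<close>, which is 1.\<close>
    ultimately have "?c (0, 0) * ?P (0, 0) = ?c (0, 0) * ?Q (0, 0)"
      by (simp add: sum.remove[of ?I "(0, 0)"])
    then show ?case by (simp add: f1)
  qed
  moreover have "ncps_coeff g [] = 1"
    using group_likeD(1)[OF fg] f1 by (simp add: ncps_coeff_mult)
  ultimately show ?thesis by (simp add: group_like_def)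
qed

lemma group_like_inv:
  assumes "group_like A f" "f \<in> ncps_units A"
  shows "group_like A (ncps_inv f)"
  using group_like_mult_cancel_left[OF assms(1)] ncps_unitsD(3)[OF assms(2)] group_like_one
  by metis

text \<open>The zero series also satisfies the shuffle relations, so the constant term has to be
  supplied separately.\<close>

lemma shuffled_iff_group_like:
  assumes "\<And>p q. gcd p q = 1 \<Longrightarrow> ncps_coeff (G (p, q)) [] = 1"
  shows "shuffled A G \<longleftrightarrow> (\<forall>p q. gcd p q = 1 \<longrightarrow> group_like A (G (p, q)))"
  using assms by (auto simp: shuffled_def group_like_def dedekind_U_def Sh_eq_shuffle_mset)

section \<open>Dedekind symbols\<close>

lemma multiple_dedekind_symbolD:
  assumes "multiple_dedekind_symbol A D" "gcd p q = 1"
  shows "D (p, q) \<in> ncps_units A" "ncps_coeff (D (p, q)) [] = 1"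
    "D (p, - q) = D (- p, q)" "D (p, p + q) = D (p, q)"
proof -
  have "(p, q) \<in> dedekind_U"
    using assms(2) by (simp add: dedekind_U_def)
  with assms(1) have "D (p, q) \<in> ncps_units A \<and> ncps_coeff (D (p, q)) [] = 1 \<and>
      D (p, - q) = D (- p, q) \<and> D (p, q) = D (p, p + q)"
    unfolding multiple_dedekind_symbol_def by blast
  then show "D (p, q) \<in> ncps_units A" "ncps_coeff (D (p, q)) [] = 1"
    "D (p, - q) = D (- p, q)" "D (p, p + q) = D (p, q)" by auto
qed

section \<open>Reduction modulo the first entry, and descent\<close>

lemma dedekind_symbol_add_mult:
  assumes D: "multiple_dedekind_symbol A D" and g: "gcd p q = 1"
  shows "D (p, k * p + q) = D (p, q)"
proof (induction k rule: int_induct[where k = 0])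
  case (step1 i)
  have "gcd p (i * p + q) = 1"
    using g by (metis gcd_add_mult)
  from multiple_dedekind_symbolD(4)[OF D this] step1 show ?case
    by (simp add: algebra_simps)
next
  case (step2 i)
  \<comment> \<open>Going down, the translation rule is applied at \<open>i - 1\<close> and read
    backwards.\<close>
  have "gcd p ((i - 1) * p + q) = 1"
    using g by (metis gcd_add_mult)
  from multiple_dedekind_symbolD(4)[OF D this] step2 show ?case
    by (simp add: algebra_simps)
qed simp

lemma dedekind_symbol_mod:
  assumes "multiple_dedekind_symbol A D" "gcd p q = 1"
  shows "D (p, q mod p) = D (p, q)"
proof -
  have "- (q div p) * p + q = q mod p"
    using div_mult_mod_eq[of q p] by linarith
  then show ?thesis
    using dedekind_symbol_add_mult[OF assms, of "- (q div p)"] by simp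
qed

text \<open>Base of the descent, where normalization enters: each \<open>(1, r)\<close> is a
  translate of \<open>(1, 1)\<close>, and the sign rule covers first entry -1.\<close>

lemma normalized_dedekind_symbol_unit:
  assumes D: "multiple_dedekind_symbol A D" and n: "normalized_symbol D" and p: "\<bar>p\<bar> = 1"
  shows "D (p, q) = 1"
proof -
  have 1: "D (1, r) = 1" for r
    using dedekind_symbol_add_mult[OF D, of 1 1 "r - 1"] n by (simp add: normalized_symbol_def)
  have "D (-1, r) = D (1, - r)" for r
    using multiple_dedekind_symbolD(3)[OF D, of 1 r] by simp
  with 1 p show ?thesis by (auto simp: abs_if split: if_splits)
qed

lemma dedekind_symbol_eq_associated_mult:
  assumes D: "multiple_dedekind_symbol A D" and g: "gcd p q = 1"
  shows "D (p, q) = associated_reciprocity D (p, q) * D (- q, p)"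
proof -
  have "gcd (- q) p = 1"
    using g by (simp add: gcd.commute)
  from ncps_unitsD(4)[OF multiple_dedekind_symbolD(1)[OF D this]] show ?thesis
    by (simp add: associated_reciprocity_def mult.assoc)
qed

text \<open>Induction on the absolute value of \<open>p\<close>: reducing \<open>q\<close> modulo
  \<open>p\<close> and then exchanging the entries makes the remainder, up to sign, the new first
  entry.\<close>

lemma group_like_dedekind_symbol:
  assumes D: "multiple_dedekind_symbol A D" and n: "normalized_symbol D"
    and F: "\<And>p q. gcd p q = 1 \<Longrightarrow> group_like A (associated_reciprocity D (p, q))"
    and g: "gcd p q = 1"
  shows "group_like A (D (p, q))"
  using g
proof (induction "nat \<bar>p\<bar>" arbitrary: p q rule: less_induct)
  case less
  consider "p = 0" | "\<bar>p\<bar> = 1" | "\<bar>p\<bar> > 1" by linarith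
  then show ?case
  proof cases
    case 1
    \<comment> \<open>Reduction modulo 0 changes nothing, but coprimality forces \<open>q\<close> to
      be 1 or -1, so one exchange already reaches the base case.\<close>
    then have "D (- q, p) = 1"
      using less.prems by (intro normalized_dedekind_symbol_unit[OF D n]) simp
    then show ?thesis
      using dedekind_symbol_eq_associated_mult[OF D less.prems] F[OF less.prems] by simp
  next
    case 2
    then show ?thesis
      by (simp add: normalized_dedekind_symbol_unit[OF D n] group_like_one)
  next
    case 3
    let ?r = "q mod p"
    have r: "gcd p ?r = 1" "gcd (- ?r) p = 1"
      using less.prems gcd_red_int[of q p] by (simp_all only: gcd_neg2_int gcd.commute[of _ p])
    have "nat \<bar>- ?r\<bar> < nat \<bar>p\<bar>"
      using 3 abs_mod_less[of p q] by simp
    from less.hyps[OF this r(2)] F[OF r(1)]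
    have "group_like A (D (p, ?r))"
      using dedekind_symbol_eq_associated_mult[OF D r(1)] by (simp add: group_like_mult)
    then show ?thesis
      by (simp add: dedekind_symbol_mod[OF D less.prems])
  qed
qed

theorem theorem4p10:
  fixes A :: "'a set"
    and D :: "int \<times> int \<Rightarrow> ('a, 'r::{comm_ring, comm_monoid_mult}) ncps"
  assumes "multiple_dedekind_symbol A D"
    and "normalized_symbol D"
  shows "shuffled A D \<longleftrightarrow> shuffled A (associated_reciprocity D)"
proof -
  note D = multiple_dedekind_symbolD[OF assms(1)]
  have F1: "ncps_coeff (associated_reciprocity D (p, q)) [] = 1" if "gcd p q = 1" for p q
    using multiple_reciprocity_function_associated[OF assms(1)] that
    unfolding multiple_reciprocity_function_def dedekind_U_def by auto
  \<comment> \<open>The forward direction: values of the reciprocity function are quotients of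
    group-like units.\<close>
  have "group_like A (associated_reciprocity D (p, q))"
    if "\<And>p q. gcd p q = 1 \<Longrightarrow> group_like A (D (p, q))" and g: "gcd p q = 1" for p q
  proof -
    have g': "gcd (- q) p = 1"
      using g by (simp add: gcd.commute)
    show ?thesis
      using group_like_mult[OF that(1)[OF g] group_like_inv[OF that(1)[OF g'] D(1)[OF g']]]
      by (simp add: associated_reciprocity_def)
  qed
  moreover note group_like_dedekind_symbol[OF assms]
  moreover have "shuffled A D \<longleftrightarrow> (\<forall>p q. gcd p q = 1 \<longrightarrow> group_like A (D (p, q)))"
    by (rule shuffled_iff_group_like) (rule D(2))
  moreover have "shuffled A (associated_reciprocity D) \<longleftrightarrow>
      (\<forall>p q. gcd p q = 1 \<longrightarrow> group_like A (associated_reciprocity D (p, q)))"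
    by (rule shuffled_iff_group_like) (rule F1)
  ultimately show ?thesis by metis
qed

end
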